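(* The horizontal geodesics of the quaternionic Heisenberg group are exactly the horizontal lifts of arcs of circles in $\mathbb{R}^4$ (with coordinates $(w,x,y,z)$), including line segments as a degenerate case.
   Context: On $\mathbb{R}^7$ with coordinates $(w,x,y,z,r,s,t)$ consider the vector fields $W=\partial_w+\frac12(x\partial_r+y\partial_s+z\partial_t)$, $X=\partial_x-\frac12(w\partial_r+z\partial_s-y\partial_t)$, $Y=\partial_y+\frac12(z\partial_r-w\partial_s-x\partial_t)$, $Z=\partial_z-\frac12(y\partial_r-x\partial_s+w\partial_t)$. The quaternionic Heisenberg group is $\mathbb{R}^7=\mathbb{H}\times\mathrm{Im}\,\mathbb{H}$ with the horizontal distribution $\mathcal{H}$ spanned by $W,X,Y,Z$, and the subriemannian inner product $(dw^2+dx^2+dy^2+dz^2)|_{\mathcal{H}}$ for which these fields are orthonormal. For a vector field $U$ let $P_U(q,p)=p(U(q))$ for $q\in\mathbb{R}^7$, $p\in T_q^*\mathbb{R}^7$; the subriemannian Hamiltonian is $H=\frac12(P_W^2+P_X^2+P_Y^2+P_Z^2)$ on $T^*\mathbb{R}^7$. A horizontal geodesic is the (nonconstant) projection to $\mathbb{R}^7$, on an interval, of a solution of the normal geodesic equations $\dot x^\alpha=\partial H/\partial p_\alpha$, $\dot p_\alpha=-\partial H/\partial x^\alpha$ in canonical coordinates $(x^\alpha,p_\alpha)$ on $T^*\mathbb{R}^7$. A horizontal lift of a curve $c$ in $\mathbb{R}^4$ is a curve in $\mathbb{R}^7$ that is everywhere tangent to $\mathcal{H}$ and projects to $c$ under $(w,x,y,z,r,s,t)\mapsto(w,x,y,z)$.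 Arcs of circles and line segments are parametrized with constant nonzero speed (a circle may be traversed more than once). *)

theory Defs
  imports "HOL-Analysis.Analysis"
begin

text \<open>
  The coordinates \<open>(w, x, y, z, r, s, t)\<close> of a point \<open>q\<close> are \<open>q $ 1, \<dots>, q $ 7\<close>, and
  \<open>axis i 1\<close> is the \<open>i\<close>-th coordinate vector field.
\<close>

definition field_W :: "real^7 \<Rightarrow> real^7" where
  "field_W q = axis 1 1 + (1/2) *\<^sub>R (q$2 *\<^sub>R axis 5 1 + q$3 *\<^sub>R axis 6 1 + q$4 *\<^sub>R axis 7 1)"

definition field_X :: "real^7 \<Rightarrow> real^7" where
  "field_X q = axis 2 1 - (1/2) *\<^sub>R (q$1 *\<^sub>R axis 5 1 + q$4 *\<^sub>R axis 6 1 - q$3 *\<^sub>R axis 7 1)"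

definition field_Y :: "real^7 \<Rightarrow> real^7" where
  "field_Y q = axis 3 1 + (1/2) *\<^sub>R (q$4 *\<^sub>R axis 5 1 - q$1 *\<^sub>R axis 6 1 - q$2 *\<^sub>R axis 7 1)"

definition field_Z :: "real^7 \<Rightarrow> real^7" where
  "field_Z q = axis 4 1 - (1/2) *\<^sub>R (q$3 *\<^sub>R axis 5 1 - q$2 *\<^sub>R axis 6 1 + q$1 *\<^sub>R axis 7 1)"

definition horizontal_space :: "real^7 \<Rightarrow> (real^7) set" where
  "horizontal_space q = span {field_W q, field_X q, field_Y q, field_Z q}"

text \<open>
  A covector is represented by its components in the canonical coordinates of the cotangent
  bundle, so its value on a tangent vector is the coordinatewise inner product.
\<close>

definition momentum :: "(real^7 \<Rightarrow> real^7) \<Rightarrow> real^7 \<Rightarrow> real^7 \<Rightarrow> real" where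
  "momentum U q p = p \<bullet> U q"

definition hamiltonian :: "real^7 \<Rightarrow> real^7 \<Rightarrow> real" where
  "hamiltonian q p =
     (1/2) * ((momentum field_W q p)\<^sup>2 + (momentum field_X q p)\<^sup>2
            + (momentum field_Y q p)\<^sup>2 + (momentum field_Z q p)\<^sup>2)"

definition hamiltonian_dq :: "7 \<Rightarrow> real^7 \<Rightarrow> real^7 \<Rightarrow> real" where
  "hamiltonian_dq i q p = deriv (\<lambda>h. hamiltonian (q + h *\<^sub>R axis i 1) p) 0"

definition hamiltonian_dp :: "7 \<Rightarrow> real^7 \<Rightarrow> real^7 \<Rightarrow> real" where
  "hamiltonian_dp i q p = deriv (\<lambda>h. hamiltonian q (p + h *\<^sub>R axis i 1)) 0"

text \<open>
  Curves are functions on the reals of which only the values on the parameter interval \<open>I\<close>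
  matter; derivatives are taken within \<open>I\<close>, i.e. one-sided at endpoints belonging to \<open>I\<close>.
\<close>

definition normal_geodesic_equations_on ::
    "real set \<Rightarrow> (real \<Rightarrow> real^7) \<Rightarrow> (real \<Rightarrow> real^7) \<Rightarrow> bool" where
  "normal_geodesic_equations_on I \<gamma> p \<longleftrightarrow>
     (\<forall>\<tau>\<in>I. \<forall>i.
        ((\<lambda>\<tau>. \<gamma> \<tau> $ i) has_real_derivative hamiltonian_dp i (\<gamma> \<tau>) (p \<tau>)) (at \<tau> within I) \<and>
        ((\<lambda>\<tau>. p \<tau> $ i) has_real_derivative - hamiltonian_dq i (\<gamma> \<tau>) (p \<tau>)) (at \<tau> within I))"

definition horizontal_geodesic_on :: "real set \<Rightarrow> (real \<Rightarrow> real^7) \<Rightarrow> bool" where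
  "horizontal_geodesic_on I \<gamma> \<longleftrightarrow>
     \<not> \<gamma> constant_on I \<and> (\<exists>p. normal_geodesic_equations_on I \<gamma> p)"

definition horizontal_projection :: "real^7 \<Rightarrow> real^4" where
  "horizontal_projection q = vector [q$1, q$2, q$3, q$4]"

definition horizontal_lift_on :: "real set \<Rightarrow> (real \<Rightarrow> real^4) \<Rightarrow> (real \<Rightarrow> real^7) \<Rightarrow> bool" where
  "horizontal_lift_on I c \<gamma> \<longleftrightarrow>
     (\<forall>\<tau>\<in>I. \<exists>v\<in>horizontal_space (\<gamma> \<tau>). (\<gamma> has_vector_derivative v) (at \<tau> within I)) \<and>
     (\<forall>\<tau>\<in>I. horizontal_projection (\<gamma> \<tau>) = c \<tau>)"

definition constant_nonzero_speed_on :: "real set \<Rightarrow> (real \<Rightarrow> real^4) \<Rightarrow> bool" where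
  "constant_nonzero_speed_on I c \<longleftrightarrow>
     (\<exists>k>0. \<forall>\<tau>\<in>I. \<exists>v. (c has_vector_derivative v) (at \<tau> within I) \<and> norm v = k)"

definition is_circle :: "(real^4) set \<Rightarrow> bool" where
  "is_circle C \<longleftrightarrow>
     (\<exists>a r P. r > 0 \<and> affine P \<and> aff_dim P = 2 \<and> a \<in> P \<and> C = P \<inter> sphere a r)"

definition is_line :: "(real^4) set \<Rightarrow> bool" where
  "is_line L \<longleftrightarrow> affine L \<and> aff_dim L = 1"

text \<open>
  A curve on an interval that stays in a circle (line) and has constant nonzero speed cannot
  reverse its direction, so it traces an arc (segment), the arc possibly more than once around.
\<close>

definition circular_arc_on :: "real set \<Rightarrow> (real \<Rightarrow> real^4) \<Rightarrow> bool" where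
  "circular_arc_on I c \<longleftrightarrow> constant_nonzero_speed_on I c \<and> (\<exists>C. is_circle C \<and> c ` I \<subseteq> C)"

definition line_segment_on :: "real set \<Rightarrow> (real \<Rightarrow> real^4) \<Rightarrow> bool" where
  "line_segment_on I c \<longleftrightarrow> constant_nonzero_speed_on I c \<and> (\<exists>L. is_line L \<and> c ` I \<subseteq> L)"

end

theory Submission
  imports Defs
begin

text \<open>
  Write \<open>u = (w, x, y, z)\<close> for the horizontal coordinates of a point, \<open>v = (P\<^sub>W, P\<^sub>X, P\<^sub>Y, P\<^sub>Z)\<close>
  for the horizontal momenta and \<open>l = (p\<^sub>5, p\<^sub>6, p\<^sub>7)\<close> for the vertical part of the covector.
  The Hamiltonian is independent of \<open>r, s, t\<close>, so \<open>l\<close> is conserved. The remaining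
  equations say that the curve has velocity \<open>P\<^sub>W W + P\<^sub>X X + P\<^sub>Y Y + P\<^sub>Z Z\<close>,
  hence \<open>u' = v\<close>, and that \<open>v' = turn l v\<close>, where \<open>turn l\<close> is quaternionic multiplication by an
  imaginary quaternion with coordinates \<open>- l\<close>. This is the law of a charged particle in a constant
  magnetic field (\<open>geodesic_equations_solvable_iff\<close>).

  Multiplication by an imaginary quaternion is skew and its square is the scalar \<open>- (norm l)\<^sup>2\<close>.
  Skewness makes the speed \<open>norm v\<close> constant. If \<open>l = 0\<close>, the velocity is constant and \<open>u\<close>
  runs along a line (\<open>turning_imp_line\<close>). If \<open>l \<noteq> 0\<close>, then \<open>u + turn l v / (norm l)\<^sup>2\<close> is a
  constant point, from which \<open>u\<close> has constant distance, and \<open>v\<close> rotates in the plane spanned by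
  its initial value and the image of that under \<open>turn l\<close>; so \<open>u\<close> runs along a circle
  (\<open>turning_imp_circle\<close>).

  Conversely, a motion of constant nonzero speed on a circle or a line cannot reverse. The velocity
  is assumed to exist but not to be continuous, so this rests on the intermediate value
  property of derivatives (\<open>derivative_nonzero_imp_same_sign\<close>, \<open>no_reversal_on_circle\<close>). Hence
  such a motion is uniform, and on a circle its velocity satisfies \<open>v' = \<kappa> J v\<close> with \<open>J\<close> the
  quarter turn in the plane of the circle. Every quarter turn of a plane in \<open>\<real>\<^sup>4\<close> is induced by an
  imaginary unit quaternion (\<open>turn_plane_charge\<close>), which supplies the vertical momentum \<open>l\<close>. The
  other components of the covector are then determined by \<open>v\<close>. Finally, a horizontal vector is
  determined by its projection to \<open>\<real>\<^sup>4\<close>, so the lifted curve has exactly the velocity that the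
  geodesic equations require.
\<close>

section \<open>Coordinates and derivatives of curves\<close>

lemma exhaust_7: fixes i :: 7 shows "i = 1 \<or> i = 2 \<or> i = 3 \<or> i = 4 \<or> i = 5 \<or> i = 6 \<or> i = 7"
proof (induct i)
  case (of_int z)
  hence "0 \<le> z" "z < 7" by simp_all
  hence "z = 0 \<or> z = 1 \<or> z = 2 \<or> z = 3 \<or> z = 4 \<or> z = 5 \<or> z = 6" by arith
  thus ?case by auto
qed

lemma forall_7: "(\<forall>i::7. P i) \<longleftrightarrow> P 1 \<and> P 2 \<and> P 3 \<and> P 4 \<and> P 5 \<and> P 6 \<and> P 7"
  by (metis exhaust_7)

lemma vector_4_nth [simp]:
  "(vector [a, b, c, d] :: ('a::zero)^4) $ 1 = a"
  "(vector [a, b, c, d] :: ('a::zero)^4) $ 2 = b"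
  "(vector [a, b, c, d] :: ('a::zero)^4) $ 3 = c"
  "(vector [a, b, c, d] :: ('a::zero)^4) $ 4 = d"
  by (simp_all add: vector_def)

lemma has_vector_derivative_iff_components:
  fixes f :: "real \<Rightarrow> real^'n"
  shows "(f has_vector_derivative D) (at t within I) \<longleftrightarrow>
    (\<forall>i. ((\<lambda>t. f t $ i) has_real_derivative D $ i) (at t within I))"
proof -
  have "(\<forall>i\<in>Basis. P i) \<longleftrightarrow> (\<forall>i. P (axis i 1))" for P :: "real^'n \<Rightarrow> bool"
    by (auto simp: Basis_vec_def)
  then show ?thesis
    unfolding has_vector_derivative_def has_field_derivative_def
    by (subst has_derivative_componentwise_within)
       (simp add: inner_axis mult.commute[of _ "D $ _"])
qed

lemma at_within_nondegenerate_interval: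
  fixes I :: "real set"
  assumes "is_interval I" "\<exists>a\<in>I. \<exists>b\<in>I. a < b" "\<tau> \<in> I"
  shows "at \<tau> within I \<noteq> bot"
proof -
  have "\<tau> islimpt I"
    using assms by (intro connected_imp_perfect) (auto simp: is_interval_connected_1)
  then show ?thesis by (simp add: trivial_limit_within)
qed

lemma constant_on_interval_if_derivative_zero:
  fixes f :: "real \<Rightarrow> 'a::real_normed_vector"
  assumes "is_interval I" "\<And>\<tau>. \<tau> \<in> I \<Longrightarrow> (f has_vector_derivative 0) (at \<tau> within I)"
    "\<sigma> \<in> I" "\<tau> \<in> I"
  shows "f \<sigma> = f \<tau>"
proof -
  obtain c where "\<And>x. x \<in> I \<Longrightarrow> f x = c"
    using has_vector_derivative_zero_constant[of I f] assms(1,2) is_interval_convex by blast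
  then show ?thesis using assms(3,4) by simp
qed

lemma vector_derivative_unique_on:
  fixes f :: "real \<Rightarrow> 'a::real_normed_vector"
  assumes "is_interval I" "\<exists>a\<in>I. \<exists>b\<in>I. a < b" "\<tau> \<in> I"
    and eq: "\<And>t. t \<in> I \<Longrightarrow> f t = g t"
    and f: "(f has_vector_derivative u) (at \<tau> within I)"
    and g: "(g has_vector_derivative v) (at \<tau> within I)"
  shows "u = v"
proof -
  have "(f has_vector_derivative v) (at \<tau> within I)"
    using has_vector_derivative_transform[OF \<open>\<tau> \<in> I\<close> eq g] by simp
  then show ?thesis
    using vector_derivative_unique_within[OF at_within_nondegenerate_interval[OF assms(1-3)] f]
    by blast
qed

lemma real_derivative_unique_on:
  fixes f :: "real \<Rightarrow> real"
  assumes "is_interval I" "\<exists>a\<in>I. \<exists>b\<in>I. a < b" "\<tau> \<in> I"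
    and "\<And>t. t \<in> I \<Longrightarrow> f t = g t"
    and "(f has_real_derivative u) (at \<tau> within I)"
    and "(g has_real_derivative v) (at \<tau> within I)"
  shows "u = v"
  using vector_derivative_unique_on[OF assms(1-4)] assms(5,6)
  by (simp add: has_real_derivative_iff_has_vector_derivative)

section \<open>Multiplication by imaginary quaternions\<close>

text \<open>
  Under \<open>v = v\<^sub>1 + v\<^sub>2 i + v\<^sub>3 j + v\<^sub>4 k\<close> this is the quaternion product
  \<open>- (l\<^sub>1 i + l\<^sub>2 j + l\<^sub>3 k) v\<close>.
\<close>

definition turn :: "real^3 \<Rightarrow> real^4 \<Rightarrow> real^4" where
  "turn l v = vector
     [ l$1 * v$2 + l$2 * v$3 + l$3 * v$4,
       - l$1 * v$1 + l$3 * v$3 - l$2 * v$4,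
       - l$2 * v$1 - l$3 * v$2 + l$1 * v$4,
       - l$3 * v$1 + l$2 * v$2 - l$1 * v$3]"

lemma turn_nth [simp]:
  "turn l v $ 1 = l$1 * v$2 + l$2 * v$3 + l$3 * v$4"
  "turn l v $ 2 = - l$1 * v$1 + l$3 * v$3 - l$2 * v$4"
  "turn l v $ 3 = - l$2 * v$1 - l$3 * v$2 + l$1 * v$4"
  "turn l v $ 4 = - l$3 * v$1 + l$2 * v$2 - l$1 * v$3"
  by (simp_all add: turn_def)

lemma bounded_linear_turn: "bounded_linear (turn l)"
  by (intro linear_conv_bounded_linear[THEN iffD1] linearI)
     (simp_all add: vec_eq_iff forall_4 algebra_simps)

lemmas turn_add = linear_add[OF bounded_linear.linear[OF bounded_linear_turn]]
lemmas turn_diff = linear_diff[OF bounded_linear.linear[OF bounded_linear_turn]]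
lemmas turn_scaleR = linear_scale[OF bounded_linear.linear[OF bounded_linear_turn]]

lemma turn_zero_left [simp]: "turn 0 v = 0"
  by (simp add: vec_eq_iff forall_4)

lemma turn_turn: "turn l (turn l v) = - (l \<bullet> l) *\<^sub>R v"
  by (simp add: vec_eq_iff forall_4 inner_vec_def sum_3 algebra_simps)

lemma inner_turn_self: "v \<bullet> turn l v = 0"
  by (simp add: inner_vec_def sum_4 algebra_simps)

lemma inner_turn_turn: "turn l v \<bullet> turn l v = (l \<bullet> l) * (v \<bullet> v)"
  by (simp add: inner_vec_def sum_3 sum_4 algebra_simps)

text \<open>
  For a unit vector \<open>e\<close> the quaternion products \<open>- i e, - j e, - k e\<close> form an orthonormal basis of
  the orthogonal complement of \<open>e\<close>; these are the coordinates of the component of \<open>f\<close> there.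
\<close>

definition plane_charge :: "real^4 \<Rightarrow> real^4 \<Rightarrow> real^3" where
  "plane_charge e f = vector [turn (axis 1 1) e \<bullet> f, turn (axis 2 1) e \<bullet> f, turn (axis 3 1) e \<bullet> f]"

text \<open>
  For an orthonormal pair the two identities say that \<open>e\<close> goes to \<open>f\<close> and \<open>f\<close> to \<open>- e\<close>, so every
  oriented plane in \<open>\<real>\<^sup>4\<close> has its quarter turn realised by an imaginary quaternion.
\<close>

lemma turn_plane_charge:
  "turn (plane_charge e f) e = (e \<bullet> e) *\<^sub>R f - (e \<bullet> f) *\<^sub>R e"
  "turn (plane_charge e f) f = (e \<bullet> f) *\<^sub>R f - (f \<bullet> f) *\<^sub>R e"
  by (simp_all add: plane_charge_def vec_eq_iff forall_4 inner_vec_def sum_4 axis_def algebra_simps)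

lemma turn_scaleR_left: "turn (k *\<^sub>R l) v = k *\<^sub>R turn l v"
  by (simp add: vec_eq_iff forall_4 algebra_simps)

section \<open>The geodesic equations in horizontal form\<close>

text \<open>
  The momentum dual to the central directions \<open>r, s, t\<close>: it acts on the projected motion as the
  charge of a particle in a magnetic field.
\<close>

definition charge :: "real^7 \<Rightarrow> real^3" where
  "charge p = vector [p$5, p$6, p$7]"

lemma charge_nth [simp]: "charge p $ 1 = p$5" "charge p $ 2 = p$6" "charge p $ 3 = p$7"
  by (simp_all add: charge_def vector_def)

lemma horizontal_projection_nth [simp]:
  "horizontal_projection q $ 1 = q$1" "horizontal_projection q $ 2 = q$2"
  "horizontal_projection q $ 3 = q$3" "horizontal_projection q $ 4 = q$4"
  by (simp_all add: horizontal_projection_def)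

lemma bounded_linear_horizontal_projection: "bounded_linear horizontal_projection"
  by (intro linear_conv_bounded_linear[THEN iffD1] linearI) (simp_all add: vec_eq_iff forall_4)

definition horizontal_vector :: "real^7 \<Rightarrow> real^4 \<Rightarrow> real^7" where
  "horizontal_vector q v =
     v$1 *\<^sub>R field_W q + v$2 *\<^sub>R field_X q + v$3 *\<^sub>R field_Y q + v$4 *\<^sub>R field_Z q"

lemmas field_defs = field_W_def field_X_def field_Y_def field_Z_def

lemma horizontal_vector_0 [simp]: "horizontal_vector q 0 = 0"
  by (simp add: horizontal_vector_def)

text \<open>The reason why a horizontal lift has its velocity prescribed by the projected curve.\<close>

lemma horizontal_projection_horizontal_vector [simp]:
  "horizontal_projection (horizontal_vector q v) = v"
  by (simp add: vec_eq_iff forall_4 horizontal_vector_def field_defs axis_def)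

lemma horizontal_space_eq: "horizontal_space q = range (horizontal_vector q)"
proof
  show "range (horizontal_vector q) \<subseteq> horizontal_space q"
    by (auto simp: horizontal_vector_def horizontal_space_def
        intro!: span_add span_scale intro: span_base)
  show "horizontal_space q \<subseteq> range (horizontal_vector q)"
  proof
    fix u assume "u \<in> horizontal_space q"
    then obtain a b c d where
      "u = a *\<^sub>R field_W q + b *\<^sub>R field_X q + c *\<^sub>R field_Y q + d *\<^sub>R field_Z q"
      unfolding horizontal_space_def span_insert span_empty by (auto simp: algebra_simps)
    then have "u = horizontal_vector q (vector [a, b, c, d])"
      by (simp add: horizontal_vector_def)
    then show "u \<in> range (horizontal_vector q)" by blast
  qed
qed

text \<open>
  The vector \<open>(P\<^sub>W, P\<^sub>X, P\<^sub>Y, P\<^sub>Z)\<close>. The vertical parts of the four fields, paired with the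
  covector, assemble into half the same quaternion product that governs the dynamics; this
  coincidence turns the equations for \<open>p\<^sub>1, \<dots>, p\<^sub>4\<close> into an equation for the momenta alone.
\<close>

definition horizontal_momentum :: "real^7 \<Rightarrow> real^7 \<Rightarrow> real^4" where
  "horizontal_momentum q p =
     horizontal_projection p + (1/2) *\<^sub>R turn (charge p) (horizontal_projection q)"

lemma momentum_eq:
  "momentum field_W q p = horizontal_momentum q p $ 1"
  "momentum field_X q p = horizontal_momentum q p $ 2"
  "momentum field_Y q p = horizontal_momentum q p $ 3"
  "momentum field_Z q p = horizontal_momentum q p $ 4"
  by (simp_all add: momentum_def field_defs inner_add_right inner_diff_right inner_axis
      horizontal_momentum_def algebra_simps)

lemma hamiltonian_dp_eq:
  "hamiltonian_dp i q p = horizontal_vector q (horizontal_momentum q p) $ i"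
  unfolding hamiltonian_dp_def
proof (rule DERIV_imp_deriv)
  have "momentum U q (p + h *\<^sub>R axis i 1) = momentum U q p + h * U q $ i" for U h
    by (simp add: momentum_def inner_add_left inner_axis')
  then show "((\<lambda>h. hamiltonian q (p + h *\<^sub>R axis i 1)) has_real_derivative
      horizontal_vector q (horizontal_momentum q p) $ i) (at 0)"
    unfolding hamiltonian_def
    by (auto intro!: derivative_eq_intros
        simp: horizontal_vector_def momentum_eq[symmetric] algebra_simps)
qed

lemma hamiltonian_dq_eq:
  "hamiltonian_dq 1 q p = - ((1/2) *\<^sub>R turn (charge p) (horizontal_momentum q p)) $ 1"
  "hamiltonian_dq 2 q p = - ((1/2) *\<^sub>R turn (charge p) (horizontal_momentum q p)) $ 2"
  "hamiltonian_dq 3 q p = - ((1/2) *\<^sub>R turn (charge p) (horizontal_momentum q p)) $ 3"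
  "hamiltonian_dq 4 q p = - ((1/2) *\<^sub>R turn (charge p) (horizontal_momentum q p)) $ 4"
  "hamiltonian_dq 5 q p = 0"
  "hamiltonian_dq 6 q p = 0"
  "hamiltonian_dq 7 q p = 0"
proof -
  \<comment> \<open>The momenta are affine in the position, with this constant derivative in direction \<open>i\<close>.\<close>
  define d where "d i = (1/2) *\<^sub>R turn (charge p) (horizontal_projection (axis i 1))" for i :: 7
  have shift: "horizontal_momentum (q + h *\<^sub>R axis i 1) p = horizontal_momentum q p + h *\<^sub>R d i"
    for h i
    by (simp add: horizontal_momentum_def d_def turn_add turn_scaleR
        linear_add[OF bounded_linear.linear[OF bounded_linear_horizontal_projection]]
        linear_scale[OF bounded_linear.linear[OF bounded_linear_horizontal_projection]] algebra_simps)
  have dq: "hamiltonian_dq i q p = horizontal_momentum q p \<bullet> d i" for i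
    unfolding hamiltonian_dq_def
  proof (rule DERIV_imp_deriv)
    show "((\<lambda>h. hamiltonian (q + h *\<^sub>R axis i 1) p) has_real_derivative
        horizontal_momentum q p \<bullet> d i) (at 0)"
      unfolding hamiltonian_def momentum_eq shift
      by (auto intro!: derivative_eq_intros simp: inner_vec_def sum_4 algebra_simps)
  qed
  show
    "hamiltonian_dq 1 q p = - ((1/2) *\<^sub>R turn (charge p) (horizontal_momentum q p)) $ 1"
    "hamiltonian_dq 2 q p = - ((1/2) *\<^sub>R turn (charge p) (horizontal_momentum q p)) $ 2"
    "hamiltonian_dq 3 q p = - ((1/2) *\<^sub>R turn (charge p) (horizontal_momentum q p)) $ 3"
    "hamiltonian_dq 4 q p = - ((1/2) *\<^sub>R turn (charge p) (horizontal_momentum q p)) $ 4"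
    "hamiltonian_dq 5 q p = 0" "hamiltonian_dq 6 q p = 0" "hamiltonian_dq 7 q p = 0"
    unfolding dq d_def
    by (simp_all add: inner_vec_def sum_4 axis_def field_simps)
qed

lemma normal_geodesic_equations_on_iff:
  "normal_geodesic_equations_on I \<gamma> p \<longleftrightarrow>
     (\<forall>\<tau>\<in>I.
        (\<gamma> has_vector_derivative horizontal_vector (\<gamma> \<tau>) (horizontal_momentum (\<gamma> \<tau>) (p \<tau>)))
          (at \<tau> within I) \<and>
        ((\<lambda>\<tau>. horizontal_projection (p \<tau>)) has_vector_derivative
          (1/2) *\<^sub>R turn (charge (p \<tau>)) (horizontal_momentum (\<gamma> \<tau>) (p \<tau>))) (at \<tau> within I) \<and>
        ((\<lambda>\<tau>. charge (p \<tau>)) has_vector_derivative 0) (at \<tau> within I))"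
proof -
  have "(\<forall>i. ((\<lambda>\<tau>. p \<tau> $ i) has_real_derivative - hamiltonian_dq i (\<gamma> \<tau>) (p \<tau>)) (at \<tau> within I)) \<longleftrightarrow>
      ((\<lambda>\<tau>. horizontal_projection (p \<tau>)) has_vector_derivative
        (1/2) *\<^sub>R turn (charge (p \<tau>)) (horizontal_momentum (\<gamma> \<tau>) (p \<tau>))) (at \<tau> within I) \<and>
      ((\<lambda>\<tau>. charge (p \<tau>)) has_vector_derivative 0) (at \<tau> within I)" for \<tau>
    unfolding has_vector_derivative_iff_components
    by (simp add: forall_7 forall_4 forall_3 hamiltonian_dq_eq)
  then show ?thesis
    unfolding normal_geodesic_equations_on_def all_conj_distrib
    by (simp add: hamiltonian_dp_eq has_vector_derivative_iff_components[of \<gamma>])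
qed

lemma horizontal_curve_projection:
  assumes "(\<gamma> has_vector_derivative horizontal_vector (\<gamma> \<tau>) v) (at \<tau> within I)"
  shows "((\<lambda>\<tau>. horizontal_projection (\<gamma> \<tau>)) has_vector_derivative v) (at \<tau> within I)"
  using bounded_linear.has_vector_derivative[OF bounded_linear_horizontal_projection assms] by simp

text \<open>
  Elimination of the covector. Its vertical part is constant, and its horizontal part and the
  velocity \<open>v\<close> determine each other along the curve. The derivative of \<open>v\<close> has two equal halves:
  one from the equation for \<open>p\<^sub>1, \<dots>, p\<^sub>4\<close>, the other from the position dependence of the momenta.
\<close>

lemma geodesic_equations_solvable_iff:
  assumes I: "is_interval I" "\<exists>a\<in>I. \<exists>b\<in>I. a < b"
  shows "(\<exists>p. normal_geodesic_equations_on I \<gamma> p) \<longleftrightarrow>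
    (\<exists>l v. \<forall>\<tau>\<in>I. (\<gamma> has_vector_derivative horizontal_vector (\<gamma> \<tau>) (v \<tau>)) (at \<tau> within I) \<and>
       (v has_vector_derivative turn l (v \<tau>)) (at \<tau> within I))"
    (is "_ = (\<exists>l v. ?turning l v)")
proof
  {
    assume "\<exists>p. normal_geodesic_equations_on I \<gamma> p"
    then obtain p where p: "normal_geodesic_equations_on I \<gamma> p" by blast
    obtain \<sigma> where s: "\<sigma> \<in> I" using I(2) by blast
    define l where "l = charge (p \<sigma>)"
    have l: "charge (p \<tau>) = l" if "\<tau> \<in> I" for \<tau>
      unfolding l_def
      by (rule constant_on_interval_if_derivative_zero[OF I(1) _ that s])
         (use p in \<open>simp add: normal_geodesic_equations_on_iff\<close>)
    define v where "v = (\<lambda>\<tau>. horizontal_projection (p \<tau>) + (1/2) *\<^sub>R turn l (horizontal_projection (\<gamma> \<tau>)))"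
    have v: "horizontal_momentum (\<gamma> \<tau>) (p \<tau>) = v \<tau>" if "\<tau> \<in> I" for \<tau>
      using l[OF that] by (simp add: horizontal_momentum_def v_def)
    have "?turning l v"
    proof (intro ballI conjI)
      fix \<tau> assume t: "\<tau> \<in> I"
      show \<gamma>: "(\<gamma> has_vector_derivative horizontal_vector (\<gamma> \<tau>) (v \<tau>)) (at \<tau> within I)"
        using p t v[OF t] by (metis normal_geodesic_equations_on_iff)
      have "((\<lambda>\<tau>. horizontal_projection (p \<tau>)) has_vector_derivative (1/2) *\<^sub>R turn l (v \<tau>)) (at \<tau> within I)"
        using p t v[OF t] l[OF t] by (metis normal_geodesic_equations_on_iff)
      from has_vector_derivative_add[OF this
          bounded_linear.has_vector_derivative[OF bounded_linear_scaleR_right[of "1/2"]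
            bounded_linear.has_vector_derivative[OF bounded_linear_turn[of l]
              horizontal_curve_projection[OF \<gamma>]]], folded v_def]
      show "(v has_vector_derivative turn l (v \<tau>)) (at \<tau> within I)"
        by (simp add: scaleR_add_left[symmetric])
    qed
    then show "\<exists>l v. ?turning l v" by blast
  }
  assume "\<exists>l v. ?turning l v"
  then obtain l v where lv: "?turning l v" by blast
  define h where "h \<tau> = v \<tau> - (1/2) *\<^sub>R turn l (horizontal_projection (\<gamma> \<tau>))" for \<tau>
  define p :: "real \<Rightarrow> real^7" where
    "p \<tau> = (\<chi> i. if i = 1 then h \<tau> $ 1 else if i = 2 then h \<tau> $ 2 else if i = 3 then h \<tau> $ 3
       else if i = 4 then h \<tau> $ 4 else if i = 5 then l $ 1 else if i = 6 then l $ 2 else l $ 3)" for \<tau>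
  have p: "horizontal_projection (p \<tau>) = h \<tau>" "charge (p \<tau>) = l" for \<tau>
    by (simp_all add: vec_eq_iff forall_4 forall_3 p_def)
  have m: "horizontal_momentum (\<gamma> \<tau>) (p \<tau>) = v \<tau>" for \<tau>
    by (simp add: horizontal_momentum_def p h_def)
  have "normal_geodesic_equations_on I \<gamma> p"
    unfolding normal_geodesic_equations_on_iff m p
  proof (intro ballI conjI)
    fix \<tau> assume t: "\<tau> \<in> I"
    show \<gamma>: "(\<gamma> has_vector_derivative horizontal_vector (\<gamma> \<tau>) (v \<tau>)) (at \<tau> within I)"
      using lv t by blast
    have "(v has_vector_derivative turn l (v \<tau>)) (at \<tau> within I)" using lv t by blast
    from has_vector_derivative_diff[OF this
          bounded_linear.has_vector_derivative[OF bounded_linear_scaleR_right[of "1/2"]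
            bounded_linear.has_vector_derivative[OF bounded_linear_turn[of l]
              horizontal_curve_projection[OF \<gamma>]]]]
    have "(h has_vector_derivative turn l (v \<tau>) - (1/2) *\<^sub>R turn l (v \<tau>)) (at \<tau> within I)"
      unfolding h_def by simp
    moreover have "turn l (v \<tau>) - (1/2) *\<^sub>R turn l (v \<tau>) = (1/2) *\<^sub>R turn l (v \<tau>)"
      by (simp add: vec_eq_iff)
    ultimately show "(h has_vector_derivative (1/2) *\<^sub>R turn l (v \<tau>)) (at \<tau> within I)" by simp
  qed simp
  then show "\<exists>p. normal_geodesic_equations_on I \<gamma> p" by blast
qed

section \<open>Velocities turning at a constant rate\<close>

text \<open>
  Skewness of \<open>turn l\<close> makes the derivative of \<open>v \<bullet> v\<close> vanish. Applied to the difference of two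
  solutions this is also the uniqueness theorem for the linear equation \<open>v' = turn l v\<close>.
\<close>

lemma turning_norm_constant:
  assumes I: "is_interval I"
    and v: "\<And>\<tau>. \<tau> \<in> I \<Longrightarrow> (v has_vector_derivative turn l (v \<tau>)) (at \<tau> within I)"
    and st: "\<sigma> \<in> I" "\<tau> \<in> I"
  shows "norm (v \<sigma>) = norm (v \<tau>)"
proof -
  have "((\<lambda>t. v t \<bullet> v t) has_vector_derivative 0) (at t within I)" if "t \<in> I" for t
    using v[OF that] unfolding has_vector_derivative_def
    by (auto intro!: derivative_eq_intros
        simp: inner_turn_self inner_commute[of "turn l (v t)"])
  from constant_on_interval_if_derivative_zero[OF I this st]
  show ?thesis by (simp add: norm_eq)
qed

text \<open>
  The exponential of \<open>turn l\<close>, which has this form because its square is \<open>- (norm l)\<^sup>2\<close>. What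
  matters below is that \<open>v\<close> never leaves the plane spanned by its value at \<open>\<sigma>\<close> and the image
  of that value.
\<close>

lemma turning_explicit:
  assumes I: "is_interval I"
    and v: "\<And>\<tau>. \<tau> \<in> I \<Longrightarrow> (v has_vector_derivative turn l (v \<tau>)) (at \<tau> within I)"
    and st: "\<sigma> \<in> I" "\<tau> \<in> I" and l: "l \<noteq> 0"
  shows "v \<tau> = cos (norm l * (\<tau> - \<sigma>)) *\<^sub>R v \<sigma> + (sin (norm l * (\<tau> - \<sigma>)) / norm l) *\<^sub>R turn l (v \<sigma>)"
proof -
  define w where "w t = cos (norm l * (t - \<sigma>)) *\<^sub>R v \<sigma> + (sin (norm l * (t - \<sigma>)) / norm l) *\<^sub>R turn l (v \<sigma>)" for t
  have w: "(w has_vector_derivative turn l (w t)) (at t within I)" for t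
    unfolding w_def
    by (rule derivative_eq_intros refl | (use l in simp; fail))+
       (use l in \<open>simp add: turn_add turn_scaleR turn_turn power2_norm_eq_inner[symmetric] power2_eq_square\<close>)
  have "((\<lambda>t. v t - w t) has_vector_derivative turn l (v t - w t)) (at t within I)" if "t \<in> I" for t
    using has_vector_derivative_diff[OF v[OF that] w] by (simp add: turn_diff)
  from turning_norm_constant[OF I this st]
  show ?thesis by (simp add: w_def)
qed

section \<open>Lines and planes in Euclidean space\<close>

lemma aff_dim_translate_subspace:
  fixes S :: "'a::euclidean_space set"
  assumes "subspace S"
  shows "affine ((+) a ` S)" "aff_dim ((+) a ` S) = dim S"
  using assms
  by (simp_all add: affine_translation[symmetric] subspace_imp_affine aff_dim_translation_eq
      aff_dim_subspace)

lemma subspace_of_affine_aff_dim: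
  fixes P :: "'a::euclidean_space set"
  assumes "affine P" "a \<in> P"
  obtains S where "subspace S" "P = (+) a ` S" "aff_dim P = dim S"
proof
  let ?S = "(\<lambda>x. x - a) ` P"
  show 1: "subspace ?S"
    by (rule affine_diffs_subspace_subtract[OF assms])
  show 2: "P = (+) a ` ?S" by (simp add: image_image)
  show "aff_dim P = dim ?S"
    by (subst 2) (rule aff_dim_translate_subspace[OF 1])
qed

lemma dim_span_orthogonal_pair:
  fixes u v :: "'a::euclidean_space"
  assumes "u \<noteq> 0" "v \<noteq> 0" "u \<bullet> v = 0"
  shows "dim (span {u, v}) = 2"
proof -
  have "u \<noteq> v" using assms by auto
  moreover have "independent {u, v}"
    using assms by (intro pairwise_orthogonal_independent)
      (auto simp: pairwise_def orthogonal_def inner_commute)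
  ultimately show ?thesis by (simp add: dim_eq_card_independent)
qed

lemma plane_orthonormal_basis:
  fixes S :: "'a::euclidean_space set"
  assumes "subspace S" "dim S = 2"
  obtains e f where "S = span {e, f}" "e \<bullet> e = 1" "f \<bullet> f = 1" "e \<bullet> f = 0"
proof -
  obtain B where B: "pairwise orthogonal B" "\<And>x. x \<in> B \<Longrightarrow> norm x = 1" "card B = dim S" "span B = S"
    using orthonormal_basis_subspace[OF assms(1)] by metis
  then obtain e f where "B = {e, f}" "e \<noteq> f" using assms(2) by (metis card_2_iff)
  with B that[of e f] show thesis
    by (auto simp: pairwise_def orthogonal_def norm_eq_1)
qed

lemma line_unit_vector:
  fixes S :: "'a::euclidean_space set"
  assumes "subspace S" "dim S = 1"
  obtains e where "S = span {e}" "e \<bullet> e = 1"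
proof -
  obtain B where B: "\<And>x. x \<in> B \<Longrightarrow> norm x = 1" "card B = dim S" "span B = S"
    using orthonormal_basis_subspace[OF assms(1)] by metis
  then obtain e where "B = {e}" using assms(2) by (metis card_1_singletonE)
  with B that[of e] show thesis by (auto simp: norm_eq_1)
qed

section \<open>Turning motions are circular or linear\<close>

definition turning_on :: "real set \<Rightarrow> (real \<Rightarrow> real^4) \<Rightarrow> (real \<Rightarrow> real^4) \<Rightarrow> real^3 \<Rightarrow> bool" where
  "turning_on I c v l \<longleftrightarrow>
     (\<forall>\<tau>\<in>I. (c has_vector_derivative v \<tau>) (at \<tau> within I) \<and>
        (v has_vector_derivative turn l (v \<tau>)) (at \<tau> within I) \<and> v \<tau> \<noteq> 0)"

lemma turning_constant_speed:
  assumes I: "is_interval I" "\<exists>a\<in>I. \<exists>b\<in>I. a < b" and t: "turning_on I c v l"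
  shows "constant_nonzero_speed_on I c"
proof -
  obtain \<sigma> where s: "\<sigma> \<in> I" using I(2) by blast
  show ?thesis
    unfolding constant_nonzero_speed_on_def
  proof (intro exI[of _ "norm (v \<sigma>)"] conjI ballI)
    show "0 < norm (v \<sigma>)" using t s by (simp add: turning_on_def)
    fix \<tau> assume "\<tau> \<in> I"
    then show "\<exists>u. (c has_vector_derivative u) (at \<tau> within I) \<and> norm u = norm (v \<sigma>)"
      using turning_norm_constant[OF I(1), of v l \<tau> \<sigma>] t s unfolding turning_on_def by blast
  qed
qed

lemma turning_imp_line:
  assumes I: "is_interval I" "\<exists>a\<in>I. \<exists>b\<in>I. a < b" and t: "turning_on I c v 0"
  shows "line_segment_on I c"
proof -
  obtain \<sigma> where s: "\<sigma> \<in> I" using I(2) by blast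
  have v: "v \<tau> = v \<sigma>" if "\<tau> \<in> I" for \<tau>
    by (rule constant_on_interval_if_derivative_zero[OF I(1) _ that s])
       (use t in \<open>auto simp: turning_on_def\<close>)
  have "((\<lambda>t. c t - t *\<^sub>R v \<sigma>) has_vector_derivative 0) (at \<tau> within I)" if "\<tau> \<in> I" for \<tau>
  proof -
    have "(c has_vector_derivative v \<sigma>) (at \<tau> within I)"
      using t that v[OF that] by (metis turning_on_def)
    moreover have "((\<lambda>t. t *\<^sub>R v \<sigma>) has_vector_derivative v \<sigma>) (at \<tau> within I)"
      by (auto intro!: derivative_eq_intros)
    ultimately show ?thesis
      using has_vector_derivative_diff by fastforce
  qed
  then have c: "c \<tau> - \<tau> *\<^sub>R v \<sigma> = c \<sigma> - \<sigma> *\<^sub>R v \<sigma>" if "\<tau> \<in> I" for \<tau>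
    using constant_on_interval_if_derivative_zero[OF I(1) _ that s] by blast
  let ?L = "(+) (c \<sigma>) ` span {v \<sigma>}"
  have "v \<sigma> \<noteq> 0" using t s by (simp add: turning_on_def)
  then have "is_line ?L"
    unfolding is_line_def using aff_dim_translate_subspace[of "span {v \<sigma>}" "c \<sigma>"]
    by (simp add: dim_span)
  moreover have "c \<tau> \<in> ?L" if "\<tau> \<in> I" for \<tau>
  proof (rule image_eqI)
    show "c \<tau> = c \<sigma> + (\<tau> - \<sigma>) *\<^sub>R v \<sigma>"
      using c[OF that] by (simp add: algebra_simps)
    show "(\<tau> - \<sigma>) *\<^sub>R v \<sigma> \<in> span {v \<sigma>}" by (intro span_scale span_base) simp
  qed
  ultimately show ?thesis
    unfolding line_segment_on_def using turning_constant_speed[OF I t] by blast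
qed

lemma turning_imp_circle:
  assumes I: "is_interval I" "\<exists>a\<in>I. \<exists>b\<in>I. a < b" and t: "turning_on I c v l" and l: "l \<noteq> 0"
  shows "circular_arc_on I c"
proof -
  obtain \<sigma> where s: "\<sigma> \<in> I" using I(2) by blast
  have c': "(c has_vector_derivative v \<tau>) (at \<tau> within I)"
    and v': "(v has_vector_derivative turn l (v \<tau>)) (at \<tau> within I)" if "\<tau> \<in> I" for \<tau>
    using t that by (auto simp: turning_on_def)
  have v0: "v \<sigma> \<noteq> 0" using t s by (simp add: turning_on_def)
  have ll: "l \<bullet> l \<noteq> 0" using l by simp
  \<comment> \<open>The centre of the circle: the acceleration \<open>turn l (v \<tau>)\<close> is \<open>l \<bullet> l\<close> times the vector
    from the moving point to it.\<close>
  define m where "m \<tau> = c \<tau> + (1 / (l \<bullet> l)) *\<^sub>R turn l (v \<tau>)" for \<tau>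
  have "(m has_vector_derivative 0) (at \<tau> within I)" if "\<tau> \<in> I" for \<tau>
  proof -
    have "(m has_vector_derivative v \<tau> + (1 / (l \<bullet> l)) *\<^sub>R turn l (turn l (v \<tau>))) (at \<tau> within I)"
      unfolding m_def
      by (intro has_vector_derivative_add c'[OF that]
          bounded_linear.has_vector_derivative[OF bounded_linear_scaleR_right]
          bounded_linear.has_vector_derivative[OF bounded_linear_turn v'[OF that]])
    then show ?thesis using ll by (simp add: turn_turn)
  qed
  then have m: "m \<tau> = m \<sigma>" if "\<tau> \<in> I" for \<tau>
    using constant_on_interval_if_derivative_zero[OF I(1) _ that s] by blast
  have c: "c \<tau> = m \<sigma> + (- 1 / (l \<bullet> l)) *\<^sub>R turn l (v \<tau>)" if "\<tau> \<in> I" for \<tau>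
    using m[OF that] by (simp add: m_def algebra_simps)
  let ?S = "span {v \<sigma>, turn l (v \<sigma>)}"
  let ?P = "(+) (m \<sigma>) ` ?S"
  let ?r = "norm (v \<sigma>) / norm l"
  have "turn l (v \<sigma>) \<noteq> 0"
    using inner_turn_turn[of l "v \<sigma>"] ll v0 by auto
  then have "dim ?S = 2"
    using v0 by (intro dim_span_orthogonal_pair) (auto simp: inner_turn_self)
  then have P: "affine ?P" "aff_dim ?P = 2"
    using aff_dim_translate_subspace[of ?S "m \<sigma>"] by simp_all
  have "m \<sigma> \<in> ?P" by (rule image_eqI[of _ _ 0]) (simp_all add: span_zero)
  moreover have "?r > 0" using v0 l by simp
  ultimately have circle: "is_circle (?P \<inter> sphere (m \<sigma>) ?r)"
    unfolding is_circle_def using P by blast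
  have "c \<tau> \<in> ?P \<inter> sphere (m \<sigma>) ?r" if "\<tau> \<in> I" for \<tau>
  proof
    have gen: "v \<sigma> \<in> ?S" "turn l (v \<sigma>) \<in> ?S" by (simp_all add: span_base)
    have "turn l (v \<tau>) \<in> ?S"
      unfolding turning_explicit[OF I(1) v' s that l, simplified]
      by (simp add: turn_add turn_scaleR turn_turn gen span_add span_diff span_scale span_neg)
    then show "c \<tau> \<in> ?P"
      using c[OF that] by (intro image_eqI[of _ _ "(- 1 / (l \<bullet> l)) *\<^sub>R turn l (v \<tau>)"]) (simp_all add: span_scale span_neg)
    have "norm (turn l (v \<tau>)) = norm l * norm (v \<sigma>)"
      using inner_turn_turn[of l "v \<tau>"] turning_norm_constant[OF I(1) v' that s]
      by (simp add: norm_eq_sqrt_inner real_sqrt_mult)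
    then show "c \<tau> \<in> sphere (m \<sigma>) ?r"
      using c[OF that] l
      by (simp add: dist_norm power2_norm_eq_inner[symmetric] power2_eq_square)
  qed
  then show ?thesis
    unfolding circular_arc_on_def using turning_constant_speed[OF I t] circle by blast
qed

section \<open>Motions of constant speed do not reverse\<close>

text \<open>
  The argument for Darboux's theorem: if the derivative were positive at \<open>a\<close> and negative at a
  later \<open>b\<close>, the maximum over \<open>[a, b]\<close> would be attained in the interior, at a zero of the
  derivative. The opposite change of sign is the same statement for \<open>- f\<close>.
\<close>

lemma derivative_nonzero_imp_same_sign:
  fixes f :: "real \<Rightarrow> real"
  assumes I: "is_interval I"
    and f: "\<And>\<tau>. \<tau> \<in> I \<Longrightarrow> (f has_real_derivative f' \<tau>) (at \<tau> within I)"
    and nz: "\<And>\<tau>. \<tau> \<in> I \<Longrightarrow> f' \<tau> \<noteq> 0"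
    and st: "\<sigma> \<in> I" "\<tau> \<in> I"
  shows "0 < f' \<sigma> \<longleftrightarrow> 0 < f' \<tau>"
proof -
  have no_change: False
    if g: "\<And>t. t \<in> I \<Longrightarrow> (g has_real_derivative g' t) (at t within I)"
      and nz: "\<And>t. t \<in> I \<Longrightarrow> g' t \<noteq> 0"
      and ab: "a \<in> I" "b \<in> I" "a < b" and sign: "0 < g' a" "g' b < 0"
    for g g' :: "real \<Rightarrow> real" and a b
  proof -
    have sub: "{a..b} \<subseteq> I"
      using mem_is_interval_1_I[OF I ab(1,2)] by auto
    have d: "(g has_real_derivative g' t) (at t within {a..b})" if "t \<in> {a..b}" for t
      using g sub that by (meson DERIV_subset subsetD)
    then have "continuous_on {a..b} g" by (rule DERIV_continuous_on)
    then obtain c where c: "c \<in> {a..b}" "\<And>t. t \<in> {a..b} \<Longrightarrow> g t \<le> g c"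
      using continuous_attains_sup[of "{a..b}" g] ab by auto
    consider "c = a" | "c = b" | "a < c" "c < b" using c(1) by fastforce
    then show False
    proof cases
      case 1
      obtain e where e: "e > 0" "\<And>h. h > 0 \<Longrightarrow> a + h \<in> {a..b} \<Longrightarrow> h < e \<Longrightarrow> g a < g (a + h)"
        using has_real_derivative_pos_inc_right[OF d[of a] sign(1)] ab by auto
      define h where "h = min (e / 2) (b - a)"
      have "h > 0" "h < e" "a + h \<in> {a..b}" using e(1) ab by (auto simp: h_def min_def)
      then show False using e(2) c(2) 1 by fastforce
    next
      case 2
      obtain e where e: "e > 0" "\<And>h. h > 0 \<Longrightarrow> b - h \<in> {a..b} \<Longrightarrow> h < e \<Longrightarrow> g b < g (b - h)"
        using has_real_derivative_neg_dec_left[OF d[of b] sign(2)] ab by auto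
      define h where "h = min (e / 2) (b - a)"
      have "h > 0" "h < e" "b - h \<in> {a..b}" using e(1) ab by (auto simp: h_def min_def)
      then show False using e(2) c(2) 2 by fastforce
    next
      case 3
      then have "at c within {a..b} = at c" by (simp add: at_within_Icc_at)
      with d[OF c(1)] have "(g has_real_derivative g' c) (at c)" by simp
      moreover have "0 < min (c - a) (b - c)" using 3 by simp
      moreover have "\<forall>y. \<bar>c - y\<bar> < min (c - a) (b - c) \<longrightarrow> g y \<le> g c"
        using c(2) by (auto simp: abs_if split: if_splits)
      ultimately have "g' c = 0" by (rule DERIV_local_max)
      with nz sub c(1) show False by blast
    qed
  qed
  have key: "0 < f' a \<longleftrightarrow> 0 < f' b" if "a \<in> I" "b \<in> I" "a < b" for a b
  proof -
    have "((\<lambda>t. - f t) has_real_derivative - f' t) (at t within I)" if "t \<in> I" for t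
      using f[OF that] by (rule DERIV_minus)
    then have "\<not> (0 < - f' a \<and> - f' b < 0)"
      using no_change[of "\<lambda>t. - f t" "\<lambda>t. - f' t" a b] nz that by auto
    moreover have "\<not> (0 < f' a \<and> f' b < 0)"
      using no_change[of f f' a b] f nz that by auto
    ultimately show ?thesis using nz[OF that(1)] nz[OF that(2)] by linarith
  qed
  show ?thesis using key st by (metis linorder_neqE)
qed

text \<open>
  The circle relation forces \<open>(x', y') = D (- y, x)\<close> with an angular velocity \<open>D\<close> of
  fixed modulus \<open>k / r\<close>, and only its sign has to be controlled. \<open>D\<close> itself is not visibly the
  derivative of a function, but near a parameter \<open>\<sigma>\<close> it has the sign of the derivative of the
  coordinate along the tangent at \<open>\<sigma>\<close>; hence \<open>D\<close> is locally constant.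
\<close>

lemma no_reversal_on_circle:
  fixes x y x' y' :: "real \<Rightarrow> real"
  assumes I: "is_interval I" "\<exists>a\<in>I. \<exists>b\<in>I. a < b"
    and x: "\<And>\<tau>. \<tau> \<in> I \<Longrightarrow> (x has_real_derivative x' \<tau>) (at \<tau> within I)"
    and y: "\<And>\<tau>. \<tau> \<in> I \<Longrightarrow> (y has_real_derivative y' \<tau>) (at \<tau> within I)"
    and circle: "\<And>\<tau>. \<tau> \<in> I \<Longrightarrow> (x \<tau>)\<^sup>2 + (y \<tau>)\<^sup>2 = r\<^sup>2" and r: "r > 0"
    and speed: "\<And>\<tau>. \<tau> \<in> I \<Longrightarrow> (x' \<tau>)\<^sup>2 + (y' \<tau>)\<^sup>2 = k\<^sup>2" and k: "k > 0"
  obtains \<kappa> where "\<And>\<tau>. \<tau> \<in> I \<Longrightarrow> x' \<tau> = - \<kappa> * y \<tau>" "\<And>\<tau>. \<tau> \<in> I \<Longrightarrow> y' \<tau> = \<kappa> * x \<tau>"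
proof -
  define D where "D \<tau> = (x \<tau> * y' \<tau> - y \<tau> * x' \<tau>) / r\<^sup>2" for \<tau>
  have tangent: "x \<tau> * x' \<tau> + y \<tau> * y' \<tau> = 0" if t: "\<tau> \<in> I" for \<tau>
  proof -
    have "((\<lambda>t. (x t)\<^sup>2 + (y t)\<^sup>2) has_real_derivative 2 * (x \<tau> * x' \<tau> + y \<tau> * y' \<tau>)) (at \<tau> within I)"
      using x[OF t] y[OF t] by (auto intro!: derivative_eq_intros simp: algebra_simps)
    from real_derivative_unique_on[OF I t _ this DERIV_const[of "r\<^sup>2"]] circle
    show ?thesis by simp
  qed
  have xy': "x' \<tau> = - D \<tau> * y \<tau>" "y' \<tau> = D \<tau> * x \<tau>" if t: "\<tau> \<in> I" for \<tau>
  proof -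
    have "r\<^sup>2 * x' \<tau> = - (x \<tau> * y' \<tau> - y \<tau> * x' \<tau>) * y \<tau>" "r\<^sup>2 * y' \<tau> = (x \<tau> * y' \<tau> - y \<tau> * x' \<tau>) * x \<tau>"
      using tangent[OF t] circle[OF t] by algebra+
    then show "x' \<tau> = - D \<tau> * y \<tau>" "y' \<tau> = D \<tau> * x \<tau>"
      using r by (simp_all add: D_def field_simps)
  qed
  have D_sq: "(D \<tau>)\<^sup>2 = (k / r)\<^sup>2" if t: "\<tau> \<in> I" for \<tau>
  proof -
    have "(D \<tau>)\<^sup>2 * r\<^sup>2 = k\<^sup>2"
      using xy'[OF t] circle[OF t] speed[OF t] by algebra
    then show ?thesis using r by (simp add: field_simps power_divide)
  qed
  have D_eq: "D \<sigma> = D \<tau>" if "\<sigma> \<in> I" "\<tau> \<in> I" "0 < D \<sigma> \<longleftrightarrow> 0 < D \<tau>" for \<sigma> \<tau>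
  proof -
    have "D \<sigma> = D \<tau> \<or> D \<sigma> = - D \<tau>"
      using D_sq[OF that(1)] D_sq[OF that(2)] by (auto simp: power2_eq_iff)
    with that(3) show ?thesis by auto
  qed
  have D_nz: "D \<tau> \<noteq> 0" if "\<tau> \<in> I" for \<tau>
    using D_sq[OF that] r k by auto
  have "eventually (\<lambda>\<tau>. D \<sigma> = D \<tau>) (at \<sigma> within I)" if s: "\<sigma> \<in> I" for \<sigma>
  proof -
    \<comment> \<open>The inner product with the position at \<open>\<sigma>\<close>, positive as long as the curve stays close to it.\<close>
    define g where "g \<tau> = x \<sigma> * x \<tau> + y \<sigma> * y \<tau>" for \<tau>
    have "continuous_on I g"
      unfolding g_def by (intro continuous_intros DERIV_continuous_on[OF x] DERIV_continuous_on[OF y])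
    moreover have g_pos: "g \<sigma> > 0"
      using circle[OF s] r by (simp add: g_def power2_eq_square)
    ultimately obtain d where d: "d > 0" "\<And>\<tau>. \<tau> \<in> I \<Longrightarrow> dist \<tau> \<sigma> < d \<Longrightarrow> g \<tau> > 0"
      using s unfolding continuous_on_iff by (smt (verit, best) dist_real_def)
    define J where "J = I \<inter> ball \<sigma> d"
    have J: "is_interval J"
      unfolding J_def using I(1) by (intro is_interval_Int) (auto simp: is_interval_ball_real)
    have JI: "J \<subseteq> I" and sJ: "\<sigma> \<in> J" using s d by (auto simp: J_def)
    have "((\<lambda>t. x \<sigma> * y t - y \<sigma> * x t) has_real_derivative D \<tau> * g \<tau>) (at \<tau> within J)"
      if t: "\<tau> \<in> J" for \<tau>
    proof -
      have "\<tau> \<in> I" using t JI by auto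
      then show ?thesis
        using DERIV_subset[OF x[of \<tau>] JI] DERIV_subset[OF y[of \<tau>] JI] xy'[of \<tau>]
        by (auto intro!: derivative_eq_intros simp: g_def algebra_simps)
    qed
    moreover have "D \<tau> * g \<tau> \<noteq> 0" if "\<tau> \<in> J" for \<tau>
      using that d(2)[of \<tau>] D_nz[of \<tau>] by (auto simp: J_def dist_commute)
    ultimately have "0 < D \<sigma> * g \<sigma> \<longleftrightarrow> 0 < D \<tau> * g \<tau>" if "\<tau> \<in> J" for \<tau>
      using derivative_nonzero_imp_same_sign[OF J, where f'="\<lambda>\<tau>. D \<tau> * g \<tau>"] sJ that by blast
    then have sign: "0 < D \<sigma> * g \<sigma> \<longleftrightarrow> 0 < D \<tau> * g \<tau>" if "\<tau> \<in> I" "dist \<tau> \<sigma> < d" for \<tau>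
      using that by (simp add: J_def dist_commute)
    have "D \<sigma> = D \<tau>" if t: "\<tau> \<in> I" "dist \<tau> \<sigma> < d" for \<tau>
      using D_eq[OF s t(1)] sign[OF t] d(2)[OF t] g_pos
      by (simp add: zero_less_mult_iff)
    then show ?thesis
      using d(1) unfolding eventually_at by blast
  qed
  then have const: "D \<sigma> = D \<tau>" if "\<sigma> \<in> I" "\<tau> \<in> I" for \<sigma> \<tau>
    using connected_local_const[of I \<sigma> \<tau> D] I(1) that by (auto simp: is_interval_connected_1)
  obtain \<sigma> where "\<sigma> \<in> I" using I(2) by blast
  then show thesis using that[of "D \<sigma>"] xy' const by metis
qed

section \<open>Circular and linear motions are turning\<close>

text \<open>
  The coordinate \<open>f\<close> along the line has a derivative of constant modulus, which by
  Darboux's theorem is constant; the charge is then zero.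
\<close>

lemma line_segment_imp_turning:
  assumes I: "is_interval I" "\<exists>a\<in>I. \<exists>b\<in>I. a < b" and c: "line_segment_on I c"
  obtains v where "turning_on I c v 0"
proof -
  obtain L k where L: "affine L" "aff_dim L = 1" "\<And>\<tau>. \<tau> \<in> I \<Longrightarrow> c \<tau> \<in> L"
    and k: "k > 0" "\<And>\<tau>. \<tau> \<in> I \<Longrightarrow> \<exists>v. (c has_vector_derivative v) (at \<tau> within I) \<and> norm v = k"
    using c unfolding line_segment_on_def is_line_def constant_nonzero_speed_on_def by blast
  obtain d where d: "\<And>\<tau>. \<tau> \<in> I \<Longrightarrow> (c has_vector_derivative d \<tau>) (at \<tau> within I)"
      "\<And>\<tau>. \<tau> \<in> I \<Longrightarrow> norm (d \<tau>) = k"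
    using k(2) by metis
  obtain \<sigma> where s: "\<sigma> \<in> I" using I(2) by blast
  obtain S where S: "subspace S" "L = (+) (c \<sigma>) ` S" "aff_dim L = dim S"
    using subspace_of_affine_aff_dim[OF L(1) L(3)[OF s]] by blast
  obtain e where e: "S = span {e}" "e \<bullet> e = 1"
    using line_unit_vector[OF S(1)] L(2) S(3) by auto
  define f where "f \<tau> = (c \<tau> - c \<sigma>) \<bullet> e" for \<tau>
  define f' where "f' \<tau> = d \<tau> \<bullet> e" for \<tau>
  have f: "(f has_real_derivative f' \<tau>) (at \<tau> within I)" if "\<tau> \<in> I" for \<tau>
    using d(1)[OF that] unfolding f_def f'_def has_vector_derivative_def has_field_derivative_def
    by (auto intro!: derivative_eq_intros)
  have c_eq: "c \<tau> = c \<sigma> + f \<tau> *\<^sub>R e" if "\<tau> \<in> I" for \<tau>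
    using L(3)[OF that] S(2) e by (auto simp: span_singleton f_def)
  have d_eq: "d \<tau> = f' \<tau> *\<^sub>R e" if t: "\<tau> \<in> I" for \<tau>
  proof (rule vector_derivative_unique_on[OF I t c_eq d(1)[OF t]])
    show "((\<lambda>\<tau>. c \<sigma> + f \<tau> *\<^sub>R e) has_vector_derivative f' \<tau> *\<^sub>R e) (at \<tau> within I)"
      using f[OF t] by (auto intro!: derivative_eq_intros)
  qed
  have abs: "\<bar>f' \<tau>\<bar> = k" if "\<tau> \<in> I" for \<tau>
    using d(2)[OF that] d_eq[OF that] e(2) by (simp add: norm_eq_1[THEN iffD2])
  have "f' \<tau> = f' \<sigma>" if "\<tau> \<in> I" for \<tau>
  proof -
    have "0 < f' \<tau> \<longleftrightarrow> 0 < f' \<sigma>"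
      by (rule derivative_nonzero_imp_same_sign[OF I(1) f _ that s]) (use abs k in fastforce)+
    then show ?thesis using abs[OF that] abs[OF s] by linarith
  qed
  then have d_const: "d \<tau> = f' \<sigma> *\<^sub>R e" if "\<tau> \<in> I" for \<tau>
    using d_eq that by metis
  have "f' \<sigma> *\<^sub>R e \<noteq> 0"
    using d(2)[OF s] d_const[OF s] k(1) by auto
  moreover have "(c has_vector_derivative f' \<sigma> *\<^sub>R e) (at \<tau> within I)" if "\<tau> \<in> I" for \<tau>
    using d(1)[OF that] d_const[OF that] by (simp only:)
  ultimately have "turning_on I c (\<lambda>\<tau>. f' \<sigma> *\<^sub>R e) 0"
    by (simp add: turning_on_def)
  then show thesis by (rule that)
qed

text \<open>
  In an orthonormal frame of the plane of the circle the velocity is \<open>\<kappa>\<close> times the quarter turn of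
  the radius vector, with constant \<open>\<kappa>\<close>. It is therefore differentiable, and its derivative is
  \<open>\<kappa>\<close> times its own quarter turn.
\<close>

lemma circular_arc_imp_turning:
  assumes I: "is_interval I" "\<exists>a\<in>I. \<exists>b\<in>I. a < b" and c: "circular_arc_on I c"
  obtains v l where "turning_on I c v l"
proof -
  obtain C k where C: "is_circle C" "\<And>\<tau>. \<tau> \<in> I \<Longrightarrow> c \<tau> \<in> C"
    and k: "k > 0" "\<And>\<tau>. \<tau> \<in> I \<Longrightarrow> \<exists>v. (c has_vector_derivative v) (at \<tau> within I) \<and> norm v = k"
    using c unfolding circular_arc_on_def constant_nonzero_speed_on_def by blast
  obtain a r P where P: "r > 0" "affine P" "aff_dim P = 2" "a \<in> P" "C = P \<inter> sphere a r"
    using C(1) unfolding is_circle_def by blast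
  obtain d where d: "\<And>\<tau>. \<tau> \<in> I \<Longrightarrow> (c has_vector_derivative d \<tau>) (at \<tau> within I)"
      "\<And>\<tau>. \<tau> \<in> I \<Longrightarrow> norm (d \<tau>) = k"
    using k(2) by metis
  obtain S where S: "subspace S" "P = (+) a ` S" "aff_dim P = dim S"
    using subspace_of_affine_aff_dim[OF P(2,4)] by blast
  obtain e f where ef: "S = span {e, f}" "e \<bullet> e = 1" "f \<bullet> f = 1" "e \<bullet> f = 0"
    using plane_orthonormal_basis[OF S(1)] P(3) S(3) by auto
  have fe: "f \<bullet> e = 0" using ef(4) by (simp add: inner_commute)
  define x y x' y' where "x \<tau> = (c \<tau> - a) \<bullet> e" and "y \<tau> = (c \<tau> - a) \<bullet> f"
    and "x' \<tau> = d \<tau> \<bullet> e" and "y' \<tau> = d \<tau> \<bullet> f" for \<tau>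
  have x: "(x has_real_derivative x' \<tau>) (at \<tau> within I)"
    and y: "(y has_real_derivative y' \<tau>) (at \<tau> within I)" if "\<tau> \<in> I" for \<tau>
    using d(1)[OF that]
    unfolding x_def y_def x'_def y'_def has_vector_derivative_def has_field_derivative_def
    by (auto intro!: derivative_eq_intros)
  have c_eq: "c \<tau> = a + (x \<tau> *\<^sub>R e + y \<tau> *\<^sub>R f)" if "\<tau> \<in> I" for \<tau>
  proof -
    have "c \<tau> - a \<in> span {e, f}" using C(2)[OF that] P(5) S(2) ef(1) by auto
    then obtain p q where "c \<tau> - a = p *\<^sub>R e + q *\<^sub>R f"
      by (auto simp: span_insert span_singleton algebra_simps)
    moreover from this have "x \<tau> = p" "y \<tau> = q"
      using ef fe by (simp_all add: x_def y_def inner_add_left)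
    ultimately show ?thesis by (simp add: algebra_simps)
  qed
  have d_eq: "d \<tau> = x' \<tau> *\<^sub>R e + y' \<tau> *\<^sub>R f" if t: "\<tau> \<in> I" for \<tau>
  proof (rule vector_derivative_unique_on[OF I t c_eq d(1)[OF t]])
    show "((\<lambda>\<tau>. a + (x \<tau> *\<^sub>R e + y \<tau> *\<^sub>R f)) has_vector_derivative x' \<tau> *\<^sub>R e + y' \<tau> *\<^sub>R f)
        (at \<tau> within I)"
      using x[OF t] y[OF t] by (auto intro!: derivative_eq_intros)
  qed
  have norm_sq: "(norm (p *\<^sub>R e + q *\<^sub>R f))\<^sup>2 = p\<^sup>2 + q\<^sup>2" for p q
    using ef fe unfolding power2_norm_eq_inner
    by (simp add: inner_add_left inner_add_right power2_eq_square)
  have "(x \<tau>)\<^sup>2 + (y \<tau>)\<^sup>2 = r\<^sup>2" if "\<tau> \<in> I" for \<tau>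
  proof -
    have "dist (c \<tau>) a = r" using C(2)[OF that] P(5) by (simp add: dist_commute)
    then have "norm (x \<tau> *\<^sub>R e + y \<tau> *\<^sub>R f) = r"
      unfolding dist_norm c_eq[OF that] by simp
    then show ?thesis using norm_sq[of "x \<tau>" "y \<tau>"] by simp
  qed
  moreover have "(x' \<tau>)\<^sup>2 + (y' \<tau>)\<^sup>2 = k\<^sup>2" if "\<tau> \<in> I" for \<tau>
    using d(2)[OF that] d_eq[OF that] norm_sq[of "x' \<tau>" "y' \<tau>"] by simp
  ultimately obtain \<kappa> where \<kappa>: "\<And>\<tau>. \<tau> \<in> I \<Longrightarrow> x' \<tau> = - \<kappa> * y \<tau>" "\<And>\<tau>. \<tau> \<in> I \<Longrightarrow> y' \<tau> = \<kappa> * x \<tau>"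
    using no_reversal_on_circle[OF I x y _ P(1) _ k(1)] by metis
  \<comment> \<open>The charge that rotates the plane of the circle with angular velocity \<open>\<kappa>\<close>.\<close>
  define l where "l = \<kappa> *\<^sub>R plane_charge e f"
  have l: "turn l e = \<kappa> *\<^sub>R f" "turn l f = - \<kappa> *\<^sub>R e"
    using ef by (simp_all add: l_def turn_scaleR_left turn_plane_charge)
  define v where "v \<tau> = (- \<kappa> * y \<tau>) *\<^sub>R e + (\<kappa> * x \<tau>) *\<^sub>R f" for \<tau>
  have dv: "d \<tau> = v \<tau>" if "\<tau> \<in> I" for \<tau>
    using d_eq[OF that] \<kappa>[OF that] by (simp add: v_def)
  have "turning_on I c v l"
    unfolding turning_on_def
  proof (intro ballI conjI)
    fix \<tau> assume t: "\<tau> \<in> I"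
    show "(c has_vector_derivative v \<tau>) (at \<tau> within I)" using d(1)[OF t] dv[OF t] by simp
    show "v \<tau> \<noteq> 0" using d(2)[OF t] dv[OF t] k(1) by auto
    have "(v has_vector_derivative (- \<kappa> * y' \<tau>) *\<^sub>R e + (\<kappa> * x' \<tau>) *\<^sub>R f) (at \<tau> within I)"
      unfolding v_def using x[OF t] y[OF t] by (auto intro!: derivative_eq_intros simp: mult.commute)
    moreover have "turn l (v \<tau>) = (- \<kappa> * y' \<tau>) *\<^sub>R e + (\<kappa> * x' \<tau>) *\<^sub>R f"
      using \<kappa>[OF t] by (simp add: v_def turn_add turn_diff turn_scaleR l algebra_simps)
    ultimately show "(v has_vector_derivative turn l (v \<tau>)) (at \<tau> within I)" by simp
  qed
  then show thesis by (rule that)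
qed

section \<open>Horizontal geodesics\<close>

theorem theorem17:
  fixes I :: "real set" and \<gamma> :: "real \<Rightarrow> real^7"
  assumes "is_interval I" and "\<exists>a\<in>I. \<exists>b\<in>I. a < b"
  shows "horizontal_geodesic_on I \<gamma> \<longleftrightarrow>
    (\<exists>c. (circular_arc_on I c \<or> line_segment_on I c) \<and> horizontal_lift_on I c \<gamma>)"
proof
  note I = assms
  obtain \<sigma> where s: "\<sigma> \<in> I" using I(2) by blast
  {
    assume geo: "horizontal_geodesic_on I \<gamma>"
    then obtain l v where
      \<gamma>: "\<And>\<tau>. \<tau> \<in> I \<Longrightarrow> (\<gamma> has_vector_derivative horizontal_vector (\<gamma> \<tau>) (v \<tau>)) (at \<tau> within I)" and
      v: "\<And>\<tau>. \<tau> \<in> I \<Longrightarrow> (v has_vector_derivative turn l (v \<tau>)) (at \<tau> within I)"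
      unfolding horizontal_geodesic_on_def geodesic_equations_solvable_iff[OF I] by blast
    \<comment> \<open>A velocity that vanishes once vanishes always, by constancy of its norm, and the
      geodesic would be constant.\<close>
    have nz: "v \<tau> \<noteq> 0" if t: "\<tau> \<in> I" for \<tau>
    proof
      assume "v \<tau> = 0"
      then have "v \<rho> = 0" if "\<rho> \<in> I" for \<rho>
        using turning_norm_constant[OF I(1) v t that] by simp
      then have "(\<gamma> has_vector_derivative 0) (at \<rho> within I)" if "\<rho> \<in> I" for \<rho>
        using \<gamma>[OF that] that by simp
      then have "\<gamma> \<rho> = \<gamma> \<sigma>" if "\<rho> \<in> I" for \<rho>
        using constant_on_interval_if_derivative_zero[OF I(1) _ that s] by blast
      then show False using geo by (auto simp: horizontal_geodesic_on_def constant_on_def)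
    qed
    let ?c = "\<lambda>\<tau>. horizontal_projection (\<gamma> \<tau>)"
    have "turning_on I ?c v l"
      unfolding turning_on_def using horizontal_curve_projection \<gamma> v nz by blast
    then have "circular_arc_on I ?c \<or> line_segment_on I ?c"
      using turning_imp_line[OF I] turning_imp_circle[OF I] by (cases "l = 0") auto
    moreover have "horizontal_lift_on I ?c \<gamma>"
      unfolding horizontal_lift_on_def horizontal_space_eq using \<gamma> by blast
    ultimately show "\<exists>c. (circular_arc_on I c \<or> line_segment_on I c) \<and> horizontal_lift_on I c \<gamma>"
      by blast
  }
  assume "\<exists>c. (circular_arc_on I c \<or> line_segment_on I c) \<and> horizontal_lift_on I c \<gamma>"
  then obtain c where c: "circular_arc_on I c \<or> line_segment_on I c" and lift: "horizontal_lift_on I c \<gamma>"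
    by blast
  obtain v l where vl: "turning_on I c v l"
    using c circular_arc_imp_turning[OF I] line_segment_imp_turning[OF I] by metis
  have proj: "horizontal_projection (\<gamma> \<tau>) = c \<tau>" if "\<tau> \<in> I" for \<tau>
    using lift that by (simp add: horizontal_lift_on_def)
  have "(\<gamma> has_vector_derivative horizontal_vector (\<gamma> \<tau>) (v \<tau>)) (at \<tau> within I)" if t: "\<tau> \<in> I" for \<tau>
  proof -
    obtain u where u: "(\<gamma> has_vector_derivative horizontal_vector (\<gamma> \<tau>) u) (at \<tau> within I)"
      using lift t unfolding horizontal_lift_on_def horizontal_space_eq by blast
    \<comment> \<open>Both are the velocity of the projected curve.\<close>
    have "u = v \<tau>"
      using vector_derivative_unique_on[OF I t proj horizontal_curve_projection[OF u]] vl t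
      by (simp add: turning_on_def)
    with u show ?thesis by simp
  qed
  then have "\<exists>p. normal_geodesic_equations_on I \<gamma> p"
    unfolding geodesic_equations_solvable_iff[OF I] using vl unfolding turning_on_def by blast
  moreover have "\<not> \<gamma> constant_on I"
  proof
    assume "\<gamma> constant_on I"
    then have "c \<tau> = c \<sigma>" if "\<tau> \<in> I" for \<tau>
      using proj[OF that] proj[OF s] that s by (metis constant_on_def)
    then have "v \<sigma> = 0"
      using vector_derivative_unique_on[OF I s _ _ has_vector_derivative_const] vl s
      by (metis turning_on_def)
    then show False using vl s by (simp add: turning_on_def)
  qed
  ultimately show "horizontal_geodesic_on I \<gamma>" by (simp add: horizontal_geodesic_on_def)
qed

end
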